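(* Let $f$ be $L$-smooth on the domain, and run any of the algorithms AdaFW, AdaAFW, AdaPFW or AdaMP (described in the context) with initial Lipschitz estimate $L_{-1}>0$ and backtracking parameters $\tau>1$ and $0<\eta\le 1$. Let $n_t$ be the total number of evaluations of the sufficient decrease condition during iterations $0,1,\dots,t$ (all of them assumed to be carried out). Then $$n_t \le \Big[1-\frac{\log \eta}{\log\tau}\Big](t+1)+\frac{1}{\log\tau}\max\Big\{\log\frac{\tau L}{L_{-1}},\,0\Big\}.$$
   Context: Setting. $\mathcal A\subset\mathbb R^p$ is a nonempty bounded (possibly infinite) set of "atoms", $\mathrm{conv}(\mathcal A)$ its convex hull, $\mathrm{lin}(\mathcal A)$ its linear span, $\mathcal B=\mathcal A\cup(-\mathcal A)$. $\|\cdot\|$ is the Euclidean norm. $f:\mathbb R^p\to\mathbb R$ is differentiable and $L$-smooth on the domain $D$, i.e. $\|\nabla f(x)-\nabla f(y)\|\le L\|x-y\|$ for all $x,y\in D$, where $L>0$, $D=\mathrm{conv}(\mathcal A)$ for the Frank-Wolfe (FW) variants AdaFW, AdaAFW, AdaPFW and $D=\mathrm{lin}(\mathcal A)$ for AdaMP. Minima and maxima that are written are assumed to be attained. Algorithms. Inputs: $x_0\in\mathcal A$, $L_{-1}>0$, tolerance $\varepsilon\ge 0$, subproblem quality $\delta\in(0,1]$, parameters $\tau>1$, $0<\eta\le1$. At iteration $t=0,1,\dots$: compute a direction $d_t$ and a maximal step-size $\gamma_t^{\max}$ (depending on the variant, see below); set $g_t=\langle-\nabla f(x_t),d_t\rangle$;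 if $g_t\le\delta\varepsilon$, stop and return $x_t$. Otherwise choose any $M\in[\eta L_{t-1},L_{t-1}]$ and set $\gamma=\min\{g_t/(M\|d_t\|^2),\gamma_t^{\max}\}$; as long as the sufficient decrease condition $f(x_t+\gamma d_t)\le f(x_t)-\gamma g_t+\frac{\gamma^2M}{2}\|d_t\|^2$ fails, replace $M$ by $\tau M$ and recompute $\gamma=\min\{g_t/(M\|d_t\|^2),\gamma_t^{\max}\}$. When the condition holds, set $\gamma_t=\gamma$, $L_t=M$, $x_{t+1}=x_t+\gamma_td_t$. Each check of this condition (successful or not) counts as one evaluation. Directions. For the FW variants, $s_t\in\mathcal A$ is any atom with $\langle\nabla f(x_t),s_t-x_t\rangle\le\delta\min_{s\in\mathcal A}\langle\nabla f(x_t),s-x_t\rangle$. For AdaAFW and AdaPFW an active set $\mathcal S_t\subseteq\mathcal A$ and weights $\alpha_{v,t}>0$ ($v\in\mathcal S_t$, $\alpha_{v,t}=0$ otherwise) with $x_t=\sum_{v\in\mathcal S_t}\alpha_{v,t}v$, $\sum_v\alpha_{v,t}=1$, are maintained, starting from $\mathcal S_0=\{x_0\}$, $\alpha_{x_0,0}=1$; and $v_t\in\mathcal S_t$ is any element with $\langle\nabla f(x_t),x_t-v_t\rangle\le\delta\min_{v\in\mathcal S_t}\langle\nabla f(x_t),x_t-v\rangle$. - AdaFW: $d_t=s_t-x_t$, $\gamma_t^{\max}=1$. - AdaAFW: if $\langle\nabla f(x_t),s_t-x_t\rangle\le\langle\nabla f(x_t),x_t-v_t\rangle$ then $d_t=s_t-x_t$,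 $\gamma_t^{\max}=1$ (FW step); otherwise $d_t=x_t-v_t$, $\gamma_t^{\max}=\alpha_{v_t,t}/(1-\alpha_{v_t,t})$ (away step). After a FW step, $\mathcal S_{t+1}=\{s_t\}$ if $\gamma_t=1$, else $\mathcal S_{t+1}=\mathcal S_t\cup\{s_t\}$, with $\alpha_{v,t+1}=(1-\gamma_t)\alpha_{v,t}$ for $v\in\mathcal S_t\setminus\{s_t\}$ and $\alpha_{s_t,t+1}=(1-\gamma_t)\alpha_{s_t,t}+\gamma_t$. After an away step, $\mathcal S_{t+1}=\mathcal S_t\setminus\{v_t\}$ if $\gamma_t=\gamma_t^{\max}$, else $\mathcal S_{t+1}=\mathcal S_t$, with $\alpha_{v,t+1}=(1+\gamma_t)\alpha_{v,t}$ for $v\in\mathcal S_t\setminus\{v_t\}$ and $\alpha_{v_t,t+1}=(1+\gamma_t)\alpha_{v_t,t}-\gamma_t$. - AdaPFW: $d_t=s_t-v_t$, $\gamma_t^{\max}=\alpha_{v_t,t}$. Then $\alpha_{s_t,t+1}=\alpha_{s_t,t}+\gamma_t$, $\alpha_{v_t,t+1}=\alpha_{v_t,t}-\gamma_t$, other weights unchanged; $\mathcal S_{t+1}=(\mathcal S_t\setminus\{v_t\})\cup\{s_t\}$ if $\alpha_{v_t,t+1}=0$, else $\mathcal S_{t+1}=\mathcal S_t\cup\{s_t\}$. - AdaMP: $s_t\in\mathcal B$ is any element with $\langle\nabla f(x_t),s_t\rangle\le\delta\min_{s\in\mathcal B}\langle\nabla f(x_t),s\rangle$; $d_t=s_t$,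 $\gamma_t^{\max}=+\infty$. *)

theory Defs
  imports "HOL-Analysis.Analysis"
begin

datatype variant = AdaFW | AdaAFW | AdaPFW | AdaMP

fun smoothness_domain :: "variant \<Rightarrow> 'a::euclidean_space set \<Rightarrow> 'a set" where
  "smoothness_domain AdaMP A = span A"
| "smoothness_domain _ A = convex hull A"

(* The data available at the start of iteration t: the point x_t, the active set S_t, the weights
   alpha_{v,t} (zero off S_t), and the previous estimate L_{t-1}. AdaFW and AdaMP do not use the
   active set and the weights. *)
record 'a state =
  point :: 'a
  active :: "'a set"
  weight :: "'a \<Rightarrow> real"
  estimate :: real

(* The free choices made in iteration t: the atoms s_t and v_t (the latter is used by AdaAFW and
   AdaPFW only) and the first value of M that is tried. *)
record 'a choice =
  atom :: 'a
  away :: 'a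
  trial :: real

definition initial_state :: "'a \<Rightarrow> real \<Rightarrow> 'a state" where
  "initial_state x0 Linit =
     \<lparr>point = x0, active = {x0}, weight = (\<lambda>v. if v = x0 then 1 else 0), estimate = Linit\<rparr>"

(* The minimum of h over C is attained, and s in C satisfies h s <= delta * min h. *)
definition approx_min :: "real \<Rightarrow> ('a \<Rightarrow> real) \<Rightarrow> 'a set \<Rightarrow> 'a \<Rightarrow> bool" where
  "approx_min \<delta> h C s \<longleftrightarrow> s \<in> C \<and> (\<exists>m. is_arg_min h (\<lambda>u. u \<in> C) m \<and> h s \<le> \<delta> * h m)"

context
  fixes grad :: "'a::euclidean_space \<Rightarrow> 'a"
begin

fun admissible :: "variant \<Rightarrow> 'a set \<Rightarrow> real \<Rightarrow> 'a state \<Rightarrow> 'a choice \<Rightarrow> bool" where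
  "admissible AdaFW A \<delta> X c \<longleftrightarrow>
     approx_min \<delta> (\<lambda>s. grad (point X) \<bullet> (s - point X)) A (atom c)"
| "admissible AdaAFW A \<delta> X c \<longleftrightarrow>
     approx_min \<delta> (\<lambda>s. grad (point X) \<bullet> (s - point X)) A (atom c) \<and>
     approx_min \<delta> (\<lambda>v. grad (point X) \<bullet> (point X - v)) (active X) (away c)"
| "admissible AdaPFW A \<delta> X c \<longleftrightarrow>
     approx_min \<delta> (\<lambda>s. grad (point X) \<bullet> (s - point X)) A (atom c) \<and>
     approx_min \<delta> (\<lambda>v. grad (point X) \<bullet> (point X - v)) (active X) (away c)"
| "admissible AdaMP A \<delta> X c \<longleftrightarrow>
     approx_min \<delta> (\<lambda>s. grad (point X) \<bullet> s) (A \<union> uminus ` A) (atom c)"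

definition is_FW_step :: "'a state \<Rightarrow> 'a choice \<Rightarrow> bool" where
  "is_FW_step X c \<longleftrightarrow>
     grad (point X) \<bullet> (atom c - point X) \<le> grad (point X) \<bullet> (point X - away c)"

fun direction :: "variant \<Rightarrow> 'a state \<Rightarrow> 'a choice \<Rightarrow> 'a" where
  "direction AdaFW X c = atom c - point X"
| "direction AdaAFW X c = (if is_FW_step X c then atom c - point X else point X - away c)"
| "direction AdaPFW X c = atom c - away c"
| "direction AdaMP X c = atom c"

(* The quotient is never evaluated at weight 1: then x_t = v_t, and the step is a FW step. *)
fun max_step :: "variant \<Rightarrow> 'a state \<Rightarrow> 'a choice \<Rightarrow> ereal" where
  "max_step AdaFW X c = 1"
| "max_step AdaAFW X c =
     (if is_FW_step X c then 1 else ereal (weight X (away c) / (1 - weight X (away c))))"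
| "max_step AdaPFW X c = ereal (weight X (away c))"
| "max_step AdaMP X c = \<infinity>"

definition gap :: "variant \<Rightarrow> 'a state \<Rightarrow> 'a choice \<Rightarrow> real" where
  "gap var X c = (- grad (point X)) \<bullet> direction var X c"

definition step_size :: "variant \<Rightarrow> 'a state \<Rightarrow> 'a choice \<Rightarrow> real \<Rightarrow> real" where
  "step_size var X c M =
     real_of_ereal (min (ereal (gap var X c / (M * (norm (direction var X c))\<^sup>2)))
       (max_step var X c))"

definition sufficient_decrease ::
  "('a \<Rightarrow> real) \<Rightarrow> variant \<Rightarrow> 'a state \<Rightarrow> 'a choice \<Rightarrow> real \<Rightarrow> bool" where
  "sufficient_decrease f var X c M \<longleftrightarrow>
     (let \<gamma> = step_size var X c M; d = direction var X c in
        f (point X + \<gamma> *\<^sub>R d) \<le> f (point X) - \<gamma> * gap var X c + \<gamma>\<^sup>2 * M / 2 * (norm d)\<^sup>2)"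

(* The i-th check of an iteration (counted from 0) uses M = tau^i * trial c. It is carried out iff
   all earlier checks have failed. The set is infinite if no check ever succeeds. *)
definition checks :: "('a \<Rightarrow> real) \<Rightarrow> real \<Rightarrow> variant \<Rightarrow> 'a state \<Rightarrow> 'a choice \<Rightarrow> nat set" where
  "checks f \<tau> var X c = {i. \<forall>j<i. \<not> sufficient_decrease f var X c (\<tau> ^ j * trial c)}"

fun next_active :: "variant \<Rightarrow> 'a state \<Rightarrow> 'a choice \<Rightarrow> real \<Rightarrow> 'a set" where
  "next_active AdaAFW X c \<gamma> =
     (if is_FW_step X c
      then (if \<gamma> = 1 then {atom c} else active X \<union> {atom c})
      else (if ereal \<gamma> = max_step AdaAFW X c then active X - {away c} else active X))"
| "next_active AdaPFW X c \<gamma> =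
     (if weight X (away c) - \<gamma> = 0 then (active X - {away c}) \<union> {atom c}
      else active X \<union> {atom c})"
| "next_active _ X c \<gamma> = active X"

(* In the AdaPFW case the two updated positions differ, since otherwise d_t = 0 and the algorithm
   has stopped. *)
fun next_weight :: "variant \<Rightarrow> 'a state \<Rightarrow> 'a choice \<Rightarrow> real \<Rightarrow> 'a \<Rightarrow> real" where
  "next_weight AdaAFW X c \<gamma> =
     (if is_FW_step X c
      then (\<lambda>v. (1 - \<gamma>) * weight X v)(atom c := (1 - \<gamma>) * weight X (atom c) + \<gamma>)
      else (\<lambda>v. (1 + \<gamma>) * weight X v)(away c := (1 + \<gamma>) * weight X (away c) - \<gamma>))"
| "next_weight AdaPFW X c \<gamma> =
     (weight X)(atom c := weight X (atom c) + \<gamma>, away c := weight X (away c) - \<gamma>)"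
| "next_weight _ X c \<gamma> = weight X"

definition next_state :: "variant \<Rightarrow> 'a state \<Rightarrow> 'a choice \<Rightarrow> real \<Rightarrow> 'a state" where
  "next_state var X c M =
     (let \<gamma> = step_size var X c M in
        \<lparr>point = point X + \<gamma> *\<^sub>R direction var X c,
         active = next_active var X c \<gamma>,
         weight = next_weight var X c \<gamma>,
         estimate = M\<rparr>)"

(* X and c record a run in which the algorithm does not stop before the line search of iteration t.
   Termination of the backtracking loop is not presupposed: the last condition only says which state
   results if some check succeeds. *)
definition ada_run ::
  "variant \<Rightarrow> 'a set \<Rightarrow> ('a \<Rightarrow> real) \<Rightarrow> real \<Rightarrow> real \<Rightarrow> real \<Rightarrow> real \<Rightarrow> 'a \<Rightarrow> real \<Rightarrow> nat \<Rightarrow>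
   (nat \<Rightarrow> 'a state) \<Rightarrow> (nat \<Rightarrow> 'a choice) \<Rightarrow> bool" where
  "ada_run var A f \<delta> \<epsilon> \<tau> \<eta> x0 Linit t X c \<longleftrightarrow>
     X 0 = initial_state x0 Linit \<and>
     (\<forall>k\<le>t.
        admissible var A \<delta> (X k) (c k) \<and>
        gap var (X k) (c k) > \<delta> * \<epsilon> \<and>
        trial (c k) \<in> {\<eta> * estimate (X k) .. estimate (X k)} \<and>
        (\<forall>i\<in>checks f \<tau> var (X k) (c k).
           sufficient_decrease f var (X k) (c k) (\<tau> ^ i * trial (c k)) \<longrightarrow>
           X (Suc k) = next_state var (X k) (c k) (\<tau> ^ i * trial (c k))))"

end

end

theory Submission
  imports Defs
begin

text \<open>
  One iteration whose line search succeeds at the check number \<open>i\<close> (counted from 0) performs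
  \<open>i + 1\<close> checks and leaves the estimate \<open>\<tau> ^ i * M\<close>, where the first trial value \<open>M\<close> is at
  least \<open>\<eta>\<close> times the previous estimate. Hence \<open>i * ln \<tau>\<close> is at most \<open>- ln \<eta>\<close> plus the
  increase of the logarithm of the estimate, and the sum over the iterations telescopes
  (\<open>sum_le_by_log_growth\<close>). It remains to bound the last estimate by the maximum of \<open>\<tau> * L\<close> and
  the initial one: a check with \<open>M \<ge> L\<close> cannot fail, so an estimate that was raised by a failed
  check is below \<open>\<tau> * L\<close>, and one that was not raised is at most the previous one
  (\<open>line_search\<close>). The same fact makes every line search finite.

  That a check with \<open>M \<ge> L\<close> succeeds is the quadratic upper bound for functions with Lipschitz
  gradient (\<open>quadratic_upper_bound\<close>). As the Lipschitz condition is available only on the convex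
  hull (or the span) of the atoms, every point that is tried has to stay there. For the variants
  with away or pairwise steps, this is where the weights matter: the maximal step is exactly the
  one that keeps the updated weights nonnegative, so the state always carries its point as a
  convex combination of atoms (\<open>feasible_next_state\<close>).
\<close>

section \<open>The quadratic upper bound\<close>

text \<open>
  Along the segment from \<open>x\<close> to \<open>y\<close>, the difference of the two sides has a derivative of constant
  sign, because the Lipschitz condition and Cauchy-Schwarz control the change of the directional
  derivative.
\<close>

lemma quadratic_upper_bound:
  fixes f :: "'a::euclidean_space \<Rightarrow> real"
  assumes der: "\<And>x. GDERIV f x :> grad x"
    and D: "convex D" and lip: "L-lipschitz_on D grad" and x: "x \<in> D" and y: "y \<in> D"
  shows "f y \<le> f x + grad x \<bullet> (y - x) + L / 2 * (norm (y - x))\<^sup>2"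
proof -
  define d where "d = y - x"
  (* The claim reads h 1 <= h 0. *)
  define h where "h u = f (x + u *\<^sub>R d) - u * (grad x \<bullet> d) - L / 2 * (norm d)\<^sup>2 * u\<^sup>2" for u :: real
  define h' where "h' u = (grad (x + u *\<^sub>R d) - grad x) \<bullet> d - L * (norm d)\<^sup>2 * u" for u :: real
  have h: "(h has_real_derivative h' u) (at u)" for u
  proof -
    have "((\<lambda>u. x + u *\<^sub>R d) has_derivative (\<lambda>r. r *\<^sub>R d)) (at u)"
      by (auto intro!: derivative_eq_intros)
    moreover have "(f has_derivative (\<lambda>r. grad (x + u *\<^sub>R d) \<bullet> r)) (at (x + u *\<^sub>R d))"
      using der[of "x + u *\<^sub>R d"] by (simp add: gderiv_def inner_commute)
    ultimately have
      "((\<lambda>u. f (x + u *\<^sub>R d)) has_derivative (\<lambda>r. grad (x + u *\<^sub>R d) \<bullet> (r *\<^sub>R d))) (at u)"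
      by (rule has_derivative_compose)
    then have "((\<lambda>u. f (x + u *\<^sub>R d)) has_real_derivative grad (x + u *\<^sub>R d) \<bullet> d) (at u)"
      by (rule has_derivative_imp_has_field_derivative) (simp add: mult.commute)
    then show ?thesis
      unfolding h_def h'_def
      by (auto intro!: derivative_eq_intros simp: inner_diff_left)
  qed
  have "h' u \<le> 0" if u: "0 \<le> u" "u \<le> 1" for u
  proof -
    have "x + u *\<^sub>R d = (1 - u) *\<^sub>R x + u *\<^sub>R y"
      by (simp add: d_def algebra_simps)
    then have "x + u *\<^sub>R d \<in> D"
      using D x y u by (simp add: convex_alt)
    then have "norm (grad (x + u *\<^sub>R d) - grad x) \<le> L * norm (u *\<^sub>R d)"
      using lipschitz_onD[OF lip _ x, of "x + u *\<^sub>R d"] by (simp add: dist_norm)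
    then have "norm (grad (x + u *\<^sub>R d) - grad x) * norm d \<le> L * norm (u *\<^sub>R d) * norm d"
      by (rule mult_right_mono) simp
    with norm_cauchy_schwarz[of "grad (x + u *\<^sub>R d) - grad x" d] u show ?thesis
      unfolding h'_def by (simp add: power2_eq_square mult_ac)
  qed
  then have "h 1 \<le> h 0"
    by (intro DERIV_nonpos_imp_nonincreasing[of 0 1 h]) (auto intro: h)
  then show ?thesis
    by (simp add: h_def d_def)
qed

section \<open>Points that are tried stay in the smoothness domain\<close>

definition convex_combination ::
  "'a::euclidean_space set \<Rightarrow> ('a \<Rightarrow> real) \<Rightarrow> 'a \<Rightarrow> bool" where
  "convex_combination S w x \<longleftrightarrow>
     finite S \<and> (\<forall>v. 0 \<le> w v) \<and> (\<forall>v. v \<notin> S \<longrightarrow> w v = 0) \<and>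
     sum w S = 1 \<and> (\<Sum>v\<in>S. w v *\<^sub>R v) = x"

lemma convex_combination_mem_hull:
  assumes "convex_combination S w x" and "S \<subseteq> A"
  shows "x \<in> convex hull A"
proof -
  have "(\<Sum>v\<in>S. w v *\<^sub>R v) \<in> convex hull A"
    by (rule convex_sum) (use assms in \<open>auto simp: convex_combination_def intro: hull_inc\<close>)
  then show ?thesis
    using assms by (simp add: convex_combination_def)
qed

lemma convex_combination_weight_le_1:
  assumes "convex_combination S w x"
  shows "w v \<le> 1"
proof (cases "v \<in> S")
  case True
  then show ?thesis
    using assms member_le_sum[of v S w] by (simp add: convex_combination_def)
qed (use assms in \<open>simp add: convex_combination_def\<close>)

lemma convex_combination_weight_1:
  assumes cc: "convex_combination S w x" and w: "w v = 1"
  shows "x = v"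
proof -
  have fin: "finite S" and v: "v \<in> S"
    using cc w by (auto simp: convex_combination_def)
  have "sum w (S - {v}) = 0"
    using cc w sum.remove[OF fin v, of w] by (simp add: convex_combination_def)
  then have "\<forall>u\<in>S - {v}. w u = 0"
    using cc by (subst (asm) sum_nonneg_eq_0_iff) (auto simp: convex_combination_def)
  then have "(\<Sum>u\<in>S - {v}. w u *\<^sub>R u) = 0"
    by (intro sum.neutral) auto
  then show ?thesis
    using cc w sum.remove[OF fin v, of "\<lambda>u. w u *\<^sub>R u"] by (simp add: convex_combination_def)
qed

text \<open>
  Every weight update of the algorithms scales all weights by \<open>a\<close> and then adds the masses \<open>b\<close> and
  \<open>b'\<close> at \<open>s\<close> and \<open>s'\<close>. The total mass and the point change accordingly whatever the signs of \<open>b\<close>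
  and \<open>b'\<close>; only nonnegativity of the result depends on the length of the step. The new active set
  is left open, so that atoms of weight 0 may be dropped or kept.
\<close>

lemma convex_combination_update:
  assumes cc: "convex_combination S w x"
    and w': "\<And>u. w' u = a * w u + (if u = s then b else 0) + (if u = s' then b' else 0)"
    and ab: "a + b + b' = 1"
    and nonneg: "\<And>u. 0 \<le> w' u"
    and S': "S' \<subseteq> insert s (insert s' S)" "\<And>u. u \<notin> S' \<Longrightarrow> w' u = 0"
  shows "convex_combination S' w' (a *\<^sub>R x + b *\<^sub>R s + b' *\<^sub>R s')"
proof -
  define W where "W = insert s (insert s' S)"
  have fin: "finite W" and sub: "S \<subseteq> W" and mem: "s \<in> W" "s' \<in> W"
    using cc by (auto simp: W_def convex_combination_def)
  have "sum w W = sum w S"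
    by (rule sum.mono_neutral_right) (use fin sub cc in \<open>auto simp: convex_combination_def\<close>)
  then have mass: "sum w W = 1"
    using cc by (simp add: convex_combination_def)
  have "(\<Sum>u\<in>W. w u *\<^sub>R u) = (\<Sum>u\<in>S. w u *\<^sub>R u)"
    by (rule sum.mono_neutral_right) (use fin sub cc in \<open>auto simp: convex_combination_def\<close>)
  then have mean: "(\<Sum>u\<in>W. w u *\<^sub>R u) = x"
    using cc by (simp add: convex_combination_def)
  have S'W: "S' \<subseteq> W"
    using S' by (simp add: W_def)
  have "sum w' S' = sum w' W"
    by (rule sum.mono_neutral_left) (use fin S'W S' in auto)
  also have "\<dots> = a * sum w W + b + b'"
    using fin mem by (simp add: w' sum.distrib sum_distrib_left)
  finally have 1: "sum w' S' = 1"
    using mass ab by simp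
  have "(\<Sum>u\<in>S'. w' u *\<^sub>R u) = (\<Sum>u\<in>W. w' u *\<^sub>R u)"
    by (rule sum.mono_neutral_left) (use fin S'W S' in auto)
  also have "\<dots> = (\<Sum>u\<in>W. a *\<^sub>R w u *\<^sub>R u + (if u = s then b *\<^sub>R s else 0)
      + (if u = s' then b' *\<^sub>R s' else 0))"
    by (intro sum.cong) (auto simp: w' scaleR_left_distrib)
  also have "\<dots> = a *\<^sub>R (\<Sum>u\<in>W. w u *\<^sub>R u) + b *\<^sub>R s + b' *\<^sub>R s'"
    using fin mem by (simp add: sum.distrib scaleR_sum_right)
  finally show ?thesis
    using 1 mean nonneg S' finite_subset[OF S'W fin] by (simp add: convex_combination_def)
qed

fun feasible :: "variant \<Rightarrow> 'a::euclidean_space set \<Rightarrow> 'a state \<Rightarrow> bool" where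
  "feasible AdaFW A X \<longleftrightarrow> point X \<in> convex hull A"
| "feasible AdaMP A X \<longleftrightarrow> point X \<in> span A"
| "feasible _ A X \<longleftrightarrow> active X \<subseteq> A \<and> convex_combination (active X) (weight X) (point X)"

lemma feasible_point:
  "feasible var A X \<Longrightarrow> point X \<in> smoothness_domain var A"
  by (cases var) (auto intro: convex_combination_mem_hull)

lemma feasible_initial_state:
  "x0 \<in> A \<Longrightarrow> feasible var A (initial_state x0 Linit)"
  by (cases var)
    (auto simp: initial_state_def convex_combination_def hull_inc span_base)

lemma convex_smoothness_domain: "convex (smoothness_domain var A)"
  by (cases var) (auto simp: subspace_imp_convex)

text \<open>
  A linear function cannot exceed its value at a point of the hull on all atoms, so the minimum
  over the atoms is at most 0, and a positive factor \<open>\<delta>\<close> does not change that sign.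
\<close>

lemma approx_min_nonpos:
  assumes s: "approx_min \<delta> (\<lambda>s. g \<bullet> (s - x)) A s" and x: "x \<in> convex hull A" and \<delta>: "0 < \<delta>"
  shows "g \<bullet> (s - x) \<le> 0"
proof -
  obtain m where m: "\<And>u. u \<in> A \<Longrightarrow> g \<bullet> (m - x) \<le> g \<bullet> (u - x)"
    and le: "g \<bullet> (s - x) \<le> \<delta> * (g \<bullet> (m - x))"
    using s unfolding approx_min_def is_arg_min_linorder by blast
  have "g \<bullet> (m - x) \<le> 0"
  proof (rule ccontr)
    assume "\<not> ?thesis"
    then have "A \<subseteq> {u. g \<bullet> x < g \<bullet> u}"
      using m by (force simp: inner_diff_right)
    then have "convex hull A \<subseteq> {u. g \<bullet> x < g \<bullet> u}"
      by (rule hull_minimal) (rule convex_halfspace_gt)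
    with x show False
      by auto
  qed
  with \<delta> le show ?thesis
    by (smt (verit) mult_nonneg_nonpos)
qed

text \<open>
  An away step is never taken from a point that is itself the only atom of positive weight: its
  direction would be 0, and the Frank-Wolfe direction does no worse. Hence the quotient that defines
  the maximal away step has a positive denominator.
\<close>

lemma away_weight_less_1:
  assumes "feasible AdaAFW A X" and "admissible grad AdaAFW A \<delta> X c" and "0 < \<delta>"
    and away: "\<not> is_FW_step grad X c"
  shows "weight X (away c) < 1"
proof (rule ccontr)
  assume "\<not> ?thesis"
  then have "weight X (away c) = 1"
    using assms convex_combination_weight_le_1[of "active X" "weight X" "point X" "away c"] by simp
  then have "point X = away c"
    using assms convex_combination_weight_1 by (metis feasible.simps(3))
  moreover have "grad (point X) \<bullet> (atom c - point X) \<le> 0"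
    using assms feasible_point[of AdaAFW A X] by (intro approx_min_nonpos[of \<delta> _ _ A]) auto
  ultimately show False
    using away by (simp add: is_FW_step_def)
qed

text \<open>
  The step size is defined by a conversion from the extended reals, which maps infinity to 0; the
  minimum is finite even for an infinite maximal step, so the conversion loses nothing.
\<close>

lemma step_size_bounds:
  assumes feas: "feasible var A X" and adm: "admissible grad var A \<delta> X c" and \<delta>: "0 < \<delta>"
    and gap: "0 < gap grad var X c" and M: "0 < M"
  shows "0 \<le> step_size grad var X c M" and "ereal (step_size grad var X c M) \<le> max_step grad var X c"
proof -
  let ?q = "gap grad var X c / (M * (norm (direction grad var X c))\<^sup>2)"
  let ?m = "min (ereal ?q) (max_step grad var X c)"
  have q: "0 \<le> ?q"
    using gap M by simp
  have max: "0 \<le> max_step grad var X c"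
  proof (cases var)
    case AdaAFW
    then show ?thesis
      using feas adm away_weight_less_1[OF _ _ \<delta>, of A X grad c]
      by (auto simp: convex_combination_def less_imp_le)
  qed (use feas in \<open>auto simp: convex_combination_def\<close>)
  have m: "0 \<le> ?m" "?m \<le> ereal ?q"
    using q max by auto
  then have fin: "ereal (real_of_ereal ?m) = ?m"
    by (intro ereal_real') (auto simp: min_def split: if_splits)
  show "0 \<le> step_size grad var X c M"
    using m by (simp add: step_size_def real_of_ereal_pos)
  show "ereal (step_size grad var X c M) \<le> max_step grad var X c"
    unfolding step_size_def fin by simp
qed

text \<open>
  In the variants with weights, the maximal steps are the ones at which a weight (or, for a
  Frank-Wolfe step, the factor of the old weights) reaches 0, which is why no weight becomes
  negative and why the atoms that the algorithms drop have weight 0.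
\<close>

lemma feasible_next_state:
  assumes feas: "feasible var A X" and adm: "admissible grad var A \<delta> X c" and \<delta>: "0 < \<delta>"
    and gap: "0 < gap grad var X c" and M: "0 < M"
  shows "feasible var A (next_state grad var X c M)"
proof -
  define \<gamma> where "\<gamma> = step_size grad var X c M"
  have \<gamma>: "0 \<le> \<gamma>" and max: "ereal \<gamma> \<le> max_step grad var X c"
    using step_size_bounds[OF assms] by (simp_all add: \<gamma>_def)
  have nxt: "next_state grad var X c M =
      \<lparr>point = point X + \<gamma> *\<^sub>R direction grad var X c, active = next_active grad var X c \<gamma>,
       weight = next_weight grad var X c \<gamma>, estimate = M\<rparr>"
    by (simp add: next_state_def \<gamma>_def Let_def)
  show ?thesis
  proof (cases var)
    case AdaFW
    have "\<gamma> \<le> 1" "atom c \<in> convex hull A" "point X \<in> convex hull A"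
      using max adm feas AdaFW by (auto simp: approx_min_def hull_inc)
    moreover have "point X + \<gamma> *\<^sub>R (atom c - point X) = (1 - \<gamma>) *\<^sub>R point X + \<gamma> *\<^sub>R atom c"
      by (simp add: algebra_simps)
    ultimately show ?thesis
      using \<gamma> convexD_alt[OF convex_convex_hull, of "point X" A "atom c" \<gamma>]
      unfolding nxt by (simp add: AdaFW)
  next
    case AdaMP
    have "atom c \<in> span A" "point X \<in> span A"
      using adm feas AdaMP by (auto simp: approx_min_def span_base span_neg)
    then show ?thesis
      unfolding nxt by (simp add: AdaMP span_add span_scale)
  next
    case AdaAFW
    have cc: "convex_combination (active X) (weight X) (point X)" and act: "active X \<subseteq> A"
      and s: "atom c \<in> A" and v: "away c \<in> active X"
      using adm feas AdaAFW by (auto simp: approx_min_def)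
    have w: "0 \<le> weight X u" and w0: "u \<notin> active X \<Longrightarrow> weight X u = 0" for u
      using cc by (auto simp: convex_combination_def)
    let ?S = "next_active grad AdaAFW X c \<gamma>" and ?w = "next_weight grad AdaAFW X c \<gamma>"
    show ?thesis
    proof (cases "is_FW_step grad X c")
      case True
      have \<gamma>1: "\<gamma> \<le> 1"
        using max True AdaAFW by simp
      have "convex_combination ?S ?w ((1 - \<gamma>) *\<^sub>R point X + \<gamma> *\<^sub>R atom c + 0 *\<^sub>R atom c)"
        by (rule convex_combination_update[OF cc]) (use True \<gamma> \<gamma>1 w w0 in \<open>auto split: if_splits\<close>)
      moreover have "(1 - \<gamma>) *\<^sub>R point X + \<gamma> *\<^sub>R atom c + 0 *\<^sub>R atom c
          = point X + \<gamma> *\<^sub>R (atom c - point X)"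
        by (simp add: algebra_simps)
      ultimately show ?thesis
        using True act s unfolding nxt by (auto simp: AdaAFW)
    next
      case False
      define \<alpha> where "\<alpha> = weight X (away c)"
      have \<alpha>: "\<alpha> < 1"
        using away_weight_less_1 feas adm \<delta> False AdaAFW by (metis \<alpha>_def)
      have "\<gamma> \<le> \<alpha> / (1 - \<alpha>)"
        using max False AdaAFW by (simp add: \<alpha>_def)
      then have nonneg: "0 \<le> (1 + \<gamma>) * \<alpha> - \<gamma>"
        using \<alpha> by (simp add: field_simps)
      have drop: "(1 + \<gamma>) * \<alpha> - \<gamma> = 0" if "\<gamma> = \<alpha> / (1 - \<alpha>)"
        using \<alpha> by (simp add: that field_simps)
      have "convex_combination ?S ?w ((1 + \<gamma>) *\<^sub>R point X + (- \<gamma>) *\<^sub>R away c + 0 *\<^sub>R away c)"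
      proof (rule convex_combination_update[OF cc])
        show "?w u = (1 + \<gamma>) * weight X u + (if u = away c then - \<gamma> else 0)
            + (if u = away c then 0 else 0)" for u
          using False by simp
        show "0 \<le> ?w u" for u
          using False \<gamma> w nonneg by (simp add: \<alpha>_def)
        show "?w u = 0" if "u \<notin> ?S" for u
        proof (cases "u = away c")
          case True
          then have "\<gamma> = \<alpha> / (1 - \<alpha>)"
            using that False v by (simp add: \<alpha>_def split: if_splits)
          then have "(1 + \<gamma>) * \<alpha> - \<gamma> = 0"
            by (rule drop)
          with True False show ?thesis
            by (simp add: \<alpha>_def)
        next
          case u: False
          with that False have "u \<notin> active X"
            by (simp split: if_splits)
          with u False w0 show ?thesis
            by simp
        qed
      qed (use False in auto)
      moreover have "(1 + \<gamma>) *\<^sub>R point X + (- \<gamma>) *\<^sub>R away c + 0 *\<^sub>R away c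
          = point X + \<gamma> *\<^sub>R (point X - away c)"
        by (simp add: algebra_simps)
      ultimately show ?thesis
        using False act unfolding nxt by (auto simp: AdaAFW)
    qed
  next
    case AdaPFW
    have cc: "convex_combination (active X) (weight X) (point X)" and act: "active X \<subseteq> A"
      and s: "atom c \<in> A" and v: "away c \<in> active X"
      using adm feas AdaPFW by (auto simp: approx_min_def)
    have w: "0 \<le> weight X u" and w0: "u \<notin> active X \<Longrightarrow> weight X u = 0" for u
      using cc by (auto simp: convex_combination_def)
    have \<gamma>v: "\<gamma> \<le> weight X (away c)"
      using max AdaPFW by simp
    (* The order of the two function updates matters only if they hit the same atom. *)
    have ne: "atom c \<noteq> away c"
      using gap AdaPFW by (auto simp: gap_def)
    let ?S = "next_active grad AdaPFW X c \<gamma>" and ?w = "next_weight grad AdaPFW X c \<gamma>"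
    have "convex_combination ?S ?w (1 *\<^sub>R point X + \<gamma> *\<^sub>R atom c + (- \<gamma>) *\<^sub>R away c)"
    proof (rule convex_combination_update[OF cc])
      show "?w u = 1 * weight X u + (if u = atom c then \<gamma> else 0)
          + (if u = away c then - \<gamma> else 0)" for u
        using ne by simp
      show "0 \<le> ?w u" for u
        using \<gamma> w \<gamma>v by simp
      show "?w u = 0" if "u \<notin> ?S" for u
      proof (cases "u = away c")
        case True
        then show ?thesis
          using that v by (simp split: if_splits)
      next
        case False
        with that have "u \<noteq> atom c" "u \<notin> active X"
          by (simp_all split: if_splits)
        with False w0 show ?thesis
          by simp
      qed
    qed auto
    moreover have "1 *\<^sub>R point X + \<gamma> *\<^sub>R atom c + (- \<gamma>) *\<^sub>R away c
        = point X + \<gamma> *\<^sub>R (atom c - away c)"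
      by (simp add: algebra_simps)
    ultimately have "convex_combination ?S ?w (point X + \<gamma> *\<^sub>R (atom c - away c))"
      by (simp only:)
    then show ?thesis
      using act s unfolding nxt by (auto simp: AdaPFW)
  qed
qed

section \<open>The line search\<close>

text \<open>
  The sufficient decrease condition is the quadratic upper bound with \<open>M\<close> in place of \<open>L\<close>. This
  holds for every step that stays in the domain, whether it is truncated at the maximal one or not.
\<close>

lemma sufficient_decrease_if_ge:
  assumes der: "\<And>x. GDERIV f x :> grad x" and lip: "L-lipschitz_on (smoothness_domain var A) grad"
    and feas: "feasible var A X" and adm: "admissible grad var A \<delta> X c" and \<delta>: "0 < \<delta>"
    and gap: "0 < gap grad var X c" and M: "0 < M" "L \<le> M"
  shows "sufficient_decrease grad f var X c M"
proof -
  define \<gamma> where "\<gamma> = step_size grad var X c M"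
  define d where "d = direction grad var X c"
  have "point X + \<gamma> *\<^sub>R d \<in> smoothness_domain var A"
    using feasible_point[OF feasible_next_state[OF feas adm \<delta> gap M(1)]]
    by (simp add: next_state_def Let_def \<gamma>_def d_def)
  then have "f (point X + \<gamma> *\<^sub>R d)
      \<le> f (point X) + grad (point X) \<bullet> (\<gamma> *\<^sub>R d) + L / 2 * (norm (\<gamma> *\<^sub>R d))\<^sup>2"
    using quadratic_upper_bound[OF der convex_smoothness_domain lip feasible_point[OF feas]]
    by fastforce
  also have "L / 2 * (norm (\<gamma> *\<^sub>R d))\<^sup>2 \<le> M / 2 * (norm (\<gamma> *\<^sub>R d))\<^sup>2"
    using M by (intro mult_right_mono) auto
  finally show ?thesis
    by (simp add: sufficient_decrease_def Let_def \<gamma>_def[symmetric] d_def[symmetric] gap_def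
        power_mult_distrib mult_ac)
qed

text \<open>
  If the search does not succeed at once, then the value that precedes the accepted one has failed
  and is therefore below \<open>L\<close>.
\<close>

lemma line_search:
  assumes der: "\<And>x. GDERIV f x :> grad x" and lip: "L-lipschitz_on (smoothness_domain var A) grad"
    and feas: "feasible var A X" and adm: "admissible grad var A \<delta> X c" and \<delta>: "0 < \<delta>"
    and gap: "0 < gap grad var X c" and M: "0 < trial c" and \<tau>: "1 < \<tau>"
  obtains i where "checks grad f \<tau> var X c = {..i}"
    and "sufficient_decrease grad f var X c (\<tau> ^ i * trial c)"
    and "\<tau> ^ i * trial c \<le> max (trial c) (\<tau> * L)"
proof -
  let ?P = "\<lambda>j. sufficient_decrease grad f var X c (\<tau> ^ j * trial c)"
  have ge: "?P j" if "L \<le> \<tau> ^ j * trial c" for j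
    using sufficient_decrease_if_ge[OF der lip feas adm \<delta> gap _ that] M \<tau> by simp
  (* Some check succeeds, since the trial values eventually exceed L. *)
  obtain n where "L / trial c < \<tau> ^ n"
    using real_arch_pow[OF \<tau>] by blast
  then have ex: "?P n"
    using M by (intro ge) (simp add: field_simps)
  define i where "i = (LEAST j. ?P j)"
  have i: "?P i"
    unfolding i_def using ex by (rule LeastI)
  have least: "\<not> ?P j" if "j < i" for j
    using that not_less_Least unfolding i_def by blast
  have "checks grad f \<tau> var X c = {..i}"
    using i least unfolding checks_def by (auto simp: not_less[symmetric])
  moreover have "\<tau> ^ i * trial c \<le> max (trial c) (\<tau> * L)"
  proof (cases i)
    case (Suc j)
    then have "\<tau> ^ j * trial c < L"
      using least[of j] ge[of j] by force
    then show ?thesis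
      using \<tau> Suc by (simp add: mult.assoc le_max_iff_disj)
  qed simp
  ultimately show thesis
    using i that by blast
qed

section \<open>Counting the checks\<close>

text \<open>
  Taking logarithms turns the growth of the estimates \<open>E\<close> over the iterations into a telescoping
  sum.
\<close>

lemma sum_le_by_log_growth:
  fixes E :: "nat \<Rightarrow> real" and i :: "nat \<Rightarrow> nat"
  assumes \<tau>: "1 < \<tau>" and \<eta>: "0 < \<eta>" and pos: "\<And>k. k \<le> n \<Longrightarrow> 0 < E k"
    and growth: "\<And>k. k < n \<Longrightarrow> \<tau> ^ i k * (\<eta> * E k) \<le> E (Suc k)"
  shows "real (\<Sum>k<n. i k) * ln \<tau> \<le> ln (E n / E 0) - real n * ln \<eta>"
  using pos growth
proof (induction n)
  case (Suc n)
  have E: "0 < E n" "0 < E (Suc n)" "0 < E 0"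
    using Suc.prems(1) by auto
  have "ln (\<tau> ^ i n * (\<eta> * E n)) \<le> ln (E (Suc n))"
    using Suc.prems(2)[of n] \<tau> \<eta> E by (subst ln_le_cancel_iff) auto
  then have "real (i n) * ln \<tau> + ln \<eta> + ln (E n) \<le> ln (E (Suc n))"
    using \<tau> \<eta> E by (simp add: ln_mult ln_realpow)
  moreover have "real (\<Sum>k<n. i k) * ln \<tau> \<le> ln (E n) - ln (E 0) - real n * ln \<eta>"
    using Suc E by (simp add: ln_div)
  ultimately have "real (\<Sum>k<Suc n. i k) * ln \<tau>
      \<le> ln (E (Suc n)) - ln (E 0) - real (Suc n) * ln \<eta>"
    by (simp add: algebra_simps)
  with E show ?case
    by (simp add: ln_div)
qed simp

theorem theorem1:
  fixes A :: "(real ^ 'p) set"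
    and f :: "real ^ 'p \<Rightarrow> real"
    and grad :: "real ^ 'p \<Rightarrow> real ^ 'p"
    and var :: variant
    and x0 :: "real ^ 'p"
    and L Linit \<delta> \<epsilon> \<tau> \<eta> :: real
    and t :: nat
    and X :: "nat \<Rightarrow> (real ^ 'p) state"
    and c :: "nat \<Rightarrow> (real ^ 'p) choice"
  assumes "A \<noteq> {}" and "bounded A"
    and "\<And>x. GDERIV f x :> grad x"
    and "L > 0" and "L-lipschitz_on (smoothness_domain var A) grad"
    and "x0 \<in> A" and "Linit > 0" and "\<epsilon> \<ge> 0" and "0 < \<delta>" and "\<delta> \<le> 1"
    and "\<tau> > 1" and "0 < \<eta>" and "\<eta> \<le> 1"
    and "ada_run grad var A f \<delta> \<epsilon> \<tau> \<eta> x0 Linit t X c"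
  shows "(\<forall>k\<le>t. finite (checks grad f \<tau> var (X k) (c k))) \<and>
    real (\<Sum>k\<le>t. card (checks grad f \<tau> var (X k) (c k)))
      \<le> (1 - ln \<eta> / ln \<tau>) * (real t + 1) + 1 / ln \<tau> * max (ln (\<tau> * L / Linit)) 0"
proof -
  define E where "E k = estimate (X k)" for k
  let ?C = "\<lambda>k. checks grad f \<tau> var (X k) (c k)"
  have init: "X 0 = initial_state x0 Linit"
    and adm: "\<And>k. k \<le> t \<Longrightarrow> admissible grad var A \<delta> (X k) (c k)"
    and gap\<epsilon>: "\<And>k. k \<le> t \<Longrightarrow> gap grad var (X k) (c k) > \<delta> * \<epsilon>"
    and tri: "\<And>k. k \<le> t \<Longrightarrow> \<eta> * E k \<le> trial (c k) \<and> trial (c k) \<le> E k"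
    and nxt: "\<And>k i. k \<le> t \<Longrightarrow> i \<in> ?C k \<Longrightarrow>
        sufficient_decrease grad f var (X k) (c k) (\<tau> ^ i * trial (c k)) \<Longrightarrow>
        X (Suc k) = next_state grad var (X k) (c k) (\<tau> ^ i * trial (c k))"
    using assms(14) unfolding ada_run_def E_def by auto
  have gap: "0 < gap grad var (X k) (c k)" if "k \<le> t" for k
  proof -
    have "0 \<le> \<delta> * \<epsilon>"
      using assms(8,9) by simp
    then show ?thesis
      using gap\<epsilon>[OF that] by linarith
  qed
  have trial_pos: "0 < trial (c k)" if "k \<le> t" "0 < E k" for k
    using tri[OF that(1)] mult_pos_pos[OF assms(12) that(2)] by linarith
  have E0: "E 0 = Linit"
    by (simp add: E_def init initial_state_def)
  have step: "\<exists>i. ?C k = {..i} \<and> E (Suc k) = \<tau> ^ i * trial (c k) \<and>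
      feasible var A (X (Suc k)) \<and> 0 < E (Suc k) \<and> E (Suc k) \<le> max (E k) (\<tau> * L)"
    if k: "k \<le> t" and feas: "feasible var A (X k)" and pos: "0 < E k" for k
  proof -
    obtain i where i: "?C k = {..i}"
        "sufficient_decrease grad f var (X k) (c k) (\<tau> ^ i * trial (c k))"
        "\<tau> ^ i * trial (c k) \<le> max (trial (c k)) (\<tau> * L)"
      using line_search[OF assms(3,5) feas adm[OF k] assms(9) gap[OF k] trial_pos[OF k pos]
          assms(11)] by blast
    have Xk: "X (Suc k) = next_state grad var (X k) (c k) (\<tau> ^ i * trial (c k))"
      using nxt[OF k _ i(2)] i(1) by simp
    then have E: "E (Suc k) = \<tau> ^ i * trial (c k)"
      by (simp add: E_def next_state_def Let_def)
    have Epos: "0 < \<tau> ^ i * trial (c k)"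
      using trial_pos[OF k pos] assms(11) by simp
    then have "feasible var A (X (Suc k))"
      unfolding Xk by (rule feasible_next_state[OF feas adm[OF k] assms(9) gap[OF k]])
    then show ?thesis
      using i E Epos tri[OF k] by force
  qed
  have inv: "feasible var A (X k) \<and> 0 < E k \<and> E k \<le> max Linit (\<tau> * L)" if "k \<le> Suc t" for k
    using that
  proof (induction k)
    case 0
    then show ?case
      using assms(6,7) E0 by (simp add: init feasible_initial_state)
  next
    case (Suc k)
    then show ?case
      using step[of k] by force
  qed
  have "\<forall>k\<in>{..t}. \<exists>i. ?C k = {..i} \<and> E (Suc k) = \<tau> ^ i * trial (c k)"
    using step inv by (meson atMost_iff le_Suc_eq)
  then obtain i where i: "\<And>k. k \<le> t \<Longrightarrow> ?C k = {..i k} \<and> E (Suc k) = \<tau> ^ i k * trial (c k)"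
    by (metis (no_types, lifting) atMost_iff)
  have "real (\<Sum>k<Suc t. i k) * ln \<tau> \<le> ln (E (Suc t) / E 0) - real (Suc t) * ln \<eta>"
  proof (rule sum_le_by_log_growth[OF assms(11,12)])
    show "\<tau> ^ i k * (\<eta> * E k) \<le> E (Suc k)" if "k < Suc t" for k
      using that i[of k] tri[of k] assms(11) by simp
  qed (use inv in auto)
  moreover have "ln (E (Suc t) / E 0) \<le> max (ln (\<tau> * L / Linit)) 0"
  proof (cases "E (Suc t) \<le> Linit")
    case True
    then have "ln (E (Suc t) / E 0) \<le> 0"
      using inv[of "Suc t"] E0 assms(7) by (simp add: ln_div)
    then show ?thesis
      by simp
  next
    case False
    then have "0 < E (Suc t)" "E (Suc t) \<le> \<tau> * L"
      using inv[of "Suc t"] by auto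
    then have "ln (E (Suc t) / E 0) \<le> ln (\<tau> * L / Linit)"
      using E0 assms(7) by (intro ln_mono) (simp_all add: divide_right_mono)
    then show ?thesis
      by simp
  qed
  ultimately have "real (\<Sum>k\<le>t. i k) * ln \<tau> \<le> max (ln (\<tau> * L / Linit)) 0 - real (Suc t) * ln \<eta>"
    by (simp only: lessThan_Suc_atMost)
  then have "real (\<Sum>k\<le>t. i k) \<le> (max (ln (\<tau> * L / Linit)) 0 - real (Suc t) * ln \<eta>) / ln \<tau>"
    using assms(11) by (simp add: pos_le_divide_eq)
  moreover have "(\<Sum>k\<le>t. card (?C k)) = (\<Sum>k\<le>t. i k) + Suc t"
    using i by (simp add: sum.distrib[of i "\<lambda>_. 1", simplified])
  ultimately have "real (\<Sum>k\<le>t. card (?C k))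
      \<le> (max (ln (\<tau> * L / Linit)) 0 - real (Suc t) * ln \<eta>) / ln \<tau> + real (Suc t)"
    by simp
  also have "\<dots> = (1 - ln \<eta> / ln \<tau>) * (real t + 1) + 1 / ln \<tau> * max (ln (\<tau> * L / Linit)) 0"
    by (simp add: diff_divide_distrib algebra_simps)
  finally show ?thesis
    using i by simp
qed

end
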